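(* Let $\mathcal{V}$ be a separable Hilbert space, $f:\mathcal{V}\to[0,\infty]$ a functional, $\gamma>0$ and $d\in\mathcal{V}$. Then for all $y\in\mathcal{V}$ $$\mathcal{L}\left(f(\cdot)+\frac{\gamma}{2}\|\cdot-d\|^2\right)(y)=\mathcal{S}_\gamma(f)\left(\frac{y}{\gamma}+d\right)+\frac{\gamma}{2}\left\|\frac{y}{\gamma}+d\right\|^2-\frac{\gamma}{2}\|d\|^2,$$ and for all $x\in\mathcal{V}$, the transform $\mathcal{L}$ of the functional $y\mapsto \mathcal{S}_\gamma(f)\left(\frac{y}{\gamma}+d\right)+\frac{\gamma}{2}\left\|\frac{y}{\gamma}+d\right\|^2-\frac{\gamma}{2}\|d\|^2$ evaluated at $x$ equals $$\mathcal{S}_\gamma^2(f)(x)+\frac{\gamma}{2}\|x-d\|^2.$$ In particular, $x\mapsto\mathcal{S}_\gamma^2(f)(x)+\frac{\gamma}{2}\|x-d\|^2$ is the lower semi-continuous convex envelope of $x\mapsto f(x)+\frac{\gamma}{2}\|x-d\|^2$, and $0\leq \mathcal{S}_\gamma^2(f)\leq f$.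
   Context: $\mathcal{V}$ is a separable Hilbert space over $\mathbb{R}$ or $\mathbb{C}$; in the complex case it is regarded as a real Hilbert space with scalar product $\mathrm{Re}\langle x,y\rangle$. For an extended-real-valued functional $g$ on $\mathcal{V}$, the Legendre transform (Fenchel conjugate) is $\mathcal{L}(g)(y)=\sup_{x\in\mathcal{V}}\left(\langle x,y\rangle-g(x)\right)$. For $\gamma>0$, $\mathcal{S}_\gamma(g)(y)=\sup_{x\in\mathcal{V}}\left(-g(x)-\frac{\gamma}{2}\|x-y\|^2\right)$ and $\mathcal{S}_\gamma^2=\mathcal{S}_\gamma\circ\mathcal{S}_\gamma$. The lower semi-continuous convex envelope of a functional is its largest lower semi-continuous convex minorant. *)

theory Defs
  imports "HOL-Analysis.Analysis"
begin

text \<open>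
  Hilbert spaces are types of sort \<open>{real_inner, complete_space}\<close>. A complex Hilbert space is
  covered as the real Hilbert space with scalar product \<open>Re \<langle>x, y\<rangle>\<close>, written \<open>x \<bullet> y\<close>; this is the
  only scalar product entering the definitions below, and it induces the same norm.

  Functionals take values in \<open>ereal\<close>. In both suprema below one of the two terms being subtracted
  is real, so \<open>\<infinity> - \<infinity>\<close> never occurs.
\<close>

definition legendre :: "('a::real_inner \<Rightarrow> ereal) \<Rightarrow> 'a \<Rightarrow> ereal"
  where "legendre g y = (SUP x. ereal (x \<bullet> y) - g x)"

definition S_transform :: "real \<Rightarrow> ('a::real_inner \<Rightarrow> ereal) \<Rightarrow> 'a \<Rightarrow> ereal"
  where "S_transform \<gamma> g y = (SUP x. - g x - ereal (\<gamma> / 2 * (norm (x - y))\<^sup>2))"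

definition lower_semicontinuous :: "('a::topological_space \<Rightarrow> ereal) \<Rightarrow> bool"
  where "lower_semicontinuous g \<longleftrightarrow> (\<forall>a. open {x. a < g x})"

text \<open>
  Convexity of an extended-real-valued functional is convexity of its epigraph in \<open>V \<times> \<real>\<close>, which
  remains meaningful when both \<open>\<infinity>\<close> and \<open>-\<infinity>\<close> are attained.
\<close>

definition ereal_convex :: "('a::real_vector \<Rightarrow> ereal) \<Rightarrow> bool"
  where "ereal_convex g \<longleftrightarrow> convex {(x, r::real). g x \<le> ereal r}"

definition is_lsc_convex_envelope :: "('a::real_normed_vector \<Rightarrow> ereal) \<Rightarrow> ('a \<Rightarrow> ereal) \<Rightarrow> bool"
  where "is_lsc_convex_envelope h g \<longleftrightarrow>
    lower_semicontinuous h \<and> ereal_convex h \<and> (\<forall>x. h x \<le> g x) \<and>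
    (\<forall>k. lower_semicontinuous k \<and> ereal_convex k \<and> (\<forall>x. k x \<le> g x) \<longrightarrow> (\<forall>x. k x \<le> h x))"

end

theory Submission
  imports Defs
begin

text \<open>
  Completing the square turns the Legendre transforms of the statement into \<open>S\<close>-transforms, so that
  \<open>S\<^sup>2 f + \<gamma>/2 \<parallel>\<cdot> - d\<parallel>\<^sup>2\<close> is the biconjugate of \<open>f + \<gamma>/2 \<parallel>\<cdot> - d\<parallel>\<^sup>2\<close>. That the biconjugate is the
  lower semicontinuous convex envelope is the Fenchel--Moreau theorem. It suffices to compare it with
  nonnegative minorants, as a minorant \<open>k\<close> may be replaced by \<open>max k 0\<close>; a point strictly below the
  graph of such a minorant is separated from the closed convex epigraph by projecting it onto the
  epigraph in the Hilbert space \<open>V \<times> \<real>\<close>, and nonnegativity disposes of vertical hyperplanes.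
\<close>

subsection \<open>Projection onto closed convex sets\<close>

text \<open>Parallelogram law: by convexity the midpoint of \<open>x\<close> and \<open>y\<close>
  lies in \<open>E\<close>, so its distance to \<open>p\<close> is at least \<open>\<delta>\<close>.
  This makes minimizing sequences Cauchy.\<close>

lemma norm_diff_le_of_near_minimal:
  fixes p x y :: "'a::real_inner"
  assumes "convex E" "x \<in> E" "y \<in> E" "0 \<le> \<delta>" "\<And>e. e \<in> E \<Longrightarrow> \<delta> \<le> norm (p - e)"
    and "(norm (p - x))\<^sup>2 \<le> \<delta>\<^sup>2 + \<epsilon>" "(norm (p - y))\<^sup>2 \<le> \<delta>\<^sup>2 + \<epsilon>"
  shows "(norm (x - y))\<^sup>2 \<le> 4 * \<epsilon>"
proof -
  define m where "m = (1/2) *\<^sub>R x + (1/2) *\<^sub>R y"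
  have "m \<in> E"
    unfolding m_def using assms(1-3) by (intro convexD) auto
  then have "\<delta>\<^sup>2 \<le> (norm (p - m))\<^sup>2"
    using assms(4,5) by (intro power_mono) auto
  moreover have "(norm (x - y))\<^sup>2 =
      2 * (norm (p - x))\<^sup>2 + 2 * (norm (p - y))\<^sup>2 - 4 * (norm (p - m))\<^sup>2"
    unfolding m_def power2_norm_eq_inner
    by (simp add: inner_simps inner_commute algebra_simps)
  ultimately show ?thesis
    using assms(6,7) by linarith
qed

text \<open>A minimizing sequence is Cauchy by the midpoint estimate, so completeness provides the
  limit; no compactness enters, as the dimension may be infinite.\<close>

lemma nearest_point_exists:
  fixes p :: "'a::{real_inner, complete_space}"
  assumes "closed E" "convex E" "E \<noteq> {}"
  obtains q where "q \<in> E" "\<And>e. e \<in> E \<Longrightarrow> norm (p - q) \<le> norm (p - e)"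
proof -
  define \<delta> where "\<delta> = (INF e\<in>E. norm (p - e))"
  have bdd: "bdd_below ((\<lambda>e. norm (p - e)) ` E)"
    by (rule bdd_belowI[of _ 0]) auto
  have lower: "\<delta> \<le> norm (p - e)" if "e \<in> E" for e
    unfolding \<delta>_def by (rule cINF_lower[OF bdd that])
  have \<delta>0: "0 \<le> \<delta>"
    unfolding \<delta>_def by (rule cINF_greatest[OF assms(3)]) auto
  have "\<exists>e\<in>E. norm (p - e) < \<delta> + 1 / Suc n" for n
  proof (rule ccontr)
    assume "\<not> ?thesis"
    then have "\<delta> + 1 / Suc n \<le> \<delta>"
      unfolding \<delta>_def by (intro cINF_greatest[OF assms(3)]) (auto simp: not_less)
    then show False by simp
  qed
  then obtain X where X: "\<And>n. X n \<in> E" "\<And>n. norm (p - X n) < \<delta> + 1 / Suc n"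
    by metis
  have lim: "(\<lambda>n. \<delta> + 1 / Suc n) \<longlonglongrightarrow> \<delta>"
    using tendsto_add[OF tendsto_const[of \<delta>] LIMSEQ_inverse_real_of_nat]
    by (simp add: inverse_eq_divide)
  have "Cauchy X"
  proof (rule metric_CauchyI)
    fix e :: real assume "0 < e"
    have "(\<lambda>n. (\<delta> + 1 / Suc n)\<^sup>2 - \<delta>\<^sup>2) \<longlonglongrightarrow> \<delta>\<^sup>2 - \<delta>\<^sup>2"
      by (intro tendsto_diff tendsto_power lim tendsto_const)
    \<comment> \<open>The factor 4 in the midpoint estimate turns \<open>e\<^sup>2 / 8\<close> into
      \<open>e\<^sup>2 / 2\<close>, which is strictly below \<open>e\<^sup>2\<close>.\<close>
    moreover have "0 < e\<^sup>2 / 8" using \<open>0 < e\<close> by simp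
    ultimately have "\<forall>\<^sub>F n in sequentially. (\<delta> + 1 / Suc n)\<^sup>2 - \<delta>\<^sup>2 < e\<^sup>2 / 8"
      by (intro order_tendstoD(2)) auto
    then obtain M where M: "\<And>n. n \<ge> M \<Longrightarrow> (\<delta> + 1 / Suc n)\<^sup>2 - \<delta>\<^sup>2 < e\<^sup>2 / 8"
      by (auto simp: eventually_sequentially)
    have near: "(norm (p - X n))\<^sup>2 \<le> \<delta>\<^sup>2 + e\<^sup>2 / 8" if "n \<ge> M" for n
    proof -
      have "(norm (p - X n))\<^sup>2 \<le> (\<delta> + 1 / Suc n)\<^sup>2"
        using X(2)[of n] by (intro power_mono) auto
      then show ?thesis using M[OF that] by linarith
    qed
    show "\<exists>M. \<forall>m\<ge>M. \<forall>n\<ge>M. dist (X m) (X n) < e"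
    proof (intro exI[of _ M] allI impI)
      fix m n assume "M \<le> m" "M \<le> n"
      then have "(norm (X m - X n))\<^sup>2 \<le> 4 * (e\<^sup>2 / 8)"
        by (intro norm_diff_le_of_near_minimal[OF assms(2) X(1) X(1) \<delta>0 lower near near])
      also have "\<dots> < e\<^sup>2" using \<open>0 < e\<close> by simp
      finally show "dist (X m) (X n) < e"
        unfolding dist_norm using \<open>0 < e\<close> by (rule power2_less_imp_less[OF _ less_imp_le])
    qed
  qed
  then obtain q where q: "X \<longlonglongrightarrow> q"
    by (auto simp: Cauchy_convergent_iff convergent_def)
  have "norm (p - q) \<le> \<delta>"
    by (rule LIMSEQ_le[OF tendsto_norm[OF tendsto_diff[OF tendsto_const q]] lim])
      (use X(2) less_imp_le in blast)
  moreover have "q \<in> E"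
    using closed_sequentially[OF assms(1) _ q] X(1) by blast
  ultimately show thesis
    using lower that by force
qed

text \<open>First-order optimality: move from \<open>q\<close> towards \<open>e\<close> by a
  fraction \<open>t\<close>, expand the squared distance, divide by \<open>t\<close> and let
  \<open>t\<close> tend to 0.\<close>

lemma nearest_point_obtuse:
  fixes p q :: "'a::real_inner"
  assumes "convex E" "q \<in> E" "e \<in> E" and nearest: "\<And>e. e \<in> E \<Longrightarrow> norm (p - q) \<le> norm (p - e)"
  shows "(e - q) \<bullet> (p - q) \<le> 0"
proof (rule ccontr)
  assume "\<not> ?thesis"
  then have pos: "0 < (e - q) \<bullet> (p - q)" by simp
  have ineq: "2 * ((e - q) \<bullet> (p - q)) \<le> t * (norm (e - q))\<^sup>2" if t: "0 < t" "t \<le> 1" for t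
  proof -
    have "(1 - t) *\<^sub>R q + t *\<^sub>R e \<in> E"
      using assms(1-3) t by (intro convexD) auto
    then have "(norm (p - q))\<^sup>2 \<le> (norm (p - ((1 - t) *\<^sub>R q + t *\<^sub>R e)))\<^sup>2"
      using nearest by (intro power_mono) auto
    also have "p - ((1 - t) *\<^sub>R q + t *\<^sub>R e) = (p - q) - t *\<^sub>R (e - q)"
      by (simp add: algebra_simps)
    also have "(norm ((p - q) - t *\<^sub>R (e - q)))\<^sup>2 =
        (norm (p - q))\<^sup>2 - t * (2 * ((e - q) \<bullet> (p - q)) - t * (norm (e - q))\<^sup>2)"
      unfolding power2_norm_eq_inner
      by (simp add: inner_simps inner_commute algebra_simps)
    finally show ?thesis
      using t by (simp add: mult_le_0_iff)
  qed
  have "(\<lambda>n. 1 / Suc n * (norm (e - q))\<^sup>2) \<longlonglongrightarrow> 0 * (norm (e - q))\<^sup>2"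
    using LIMSEQ_inverse_real_of_nat
    by (intro tendsto_mult tendsto_const) (simp add: inverse_eq_divide)
  then have "2 * ((e - q) \<bullet> (p - q)) \<le> 0 * (norm (e - q))\<^sup>2"
    by (rule LIMSEQ_le_const) (intro exI[of _ 0] allI impI ineq, auto)
  then show False using pos by simp
qed

subsection \<open>Affine minorants\<close>

text \<open>A point strictly below the graph has an open box around it in the complement: a real
  \<open>a\<close> strictly between \<open>r\<close> and \<open>k x\<close> bounds the box from
  above, and lower semicontinuity makes its base open.\<close>

lemma closed_epigraph:
  assumes "lower_semicontinuous k"
  shows "closed {(x, r::real). k x \<le> ereal r}"
  unfolding closed_def
proof (rule open_prod_intro)
  fix z assume "z \<in> - {(x, r::real). k x \<le> ereal r}"
  then obtain x r where z: "z = (x, r)" "ereal r < k x"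
    by (cases z) (auto simp: not_le)
  obtain a where a: "ereal r < ereal a" "ereal a < k x"
    using ereal_dense2[OF z(2)] by blast
  show "\<exists>A B. open A \<and> open B \<and> z \<in> A \<times> B \<and> A \<times> B \<subseteq> - {(x, r::real). k x \<le> ereal r}"
  proof (intro exI conjI)
    show "open {x. ereal a < k x}" using assms unfolding lower_semicontinuous_def by blast
    show "open {..<a}" by simp
    show "z \<in> {x. ereal a < k x} \<times> {..<a}" using z a by simp
    show "{x. ereal a < k x} \<times> {..<a} \<subseteq> - {(x, r::real). k x \<le> ereal r}"
    proof clarsimp
      fix y s assume "k y \<le> ereal s" "s < a" "ereal a < k y"
      then show False by (meson less_ereal.simps(1) less_trans not_less)
    qed
  qed
qed

lemma affine_minorant:
  fixes k :: "'a::{real_inner, complete_space} \<Rightarrow> ereal"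
  assumes "lower_semicontinuous k" "ereal_convex k" and nonneg: "\<And>x. 0 \<le> k x"
    and below: "ereal a < k x0"
  obtains v c where "\<And>x. ereal (x \<bullet> v + c) \<le> k x" "a < x0 \<bullet> v + c"
proof (cases "\<forall>x. k x = \<infinity>")
  case True
  \<comment> \<open>The epigraph is empty here, so there is nothing to project onto; any constant
    above \<open>a\<close> serves.\<close>
  then show ?thesis using that[of 0 "a + 1"] by simp
next
  case False
  define E where "E = {(x, r::real). k x \<le> ereal r}"
  from False obtain x1 where "k x1 \<noteq> \<infinity>" by blast
  then obtain r1 where "k x1 = ereal r1"
    using nonneg[of x1] by (cases "k x1") auto
  then have "(x1, r1) \<in> E" by (simp add: E_def)
  moreover have E: "closed E" "convex E"
    using closed_epigraph[OF assms(1)] assms(2) by (auto simp: E_def ereal_convex_def)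
  ultimately obtain q where q: "q \<in> E" "\<And>e. e \<in> E \<Longrightarrow> norm ((x0, a) - q) \<le> norm ((x0, a) - e)"
    by (metis nearest_point_exists empty_iff)
  obtain q1 q2 where q_eq: "q = (q1, q2)" by (cases q)
  define u where "u = x0 - q1"
  define s where "s = a - q2"
  \<comment> \<open>The vector \<open>(u, s)\<close> from the projection to \<open>(x0, a)\<close>
    is normal to a hyperplane through \<open>q\<close> that has the epigraph on one side.\<close>
  have sep: "(x - q1) \<bullet> u + (r - q2) * s \<le> 0" if "k x \<le> ereal r" for x r
    using nearest_point_obtuse[OF E(2) q(1) _ q(2), of "(x, r)"] that
    by (simp add: E_def q_eq u_def s_def inner_prod_def)
  have "(x0, a) \<notin> E" using below by (simp add: E_def)
  then have "u \<noteq> 0 \<or> s \<noteq> 0"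
    using q(1) by (auto simp: q_eq u_def s_def)
  \<comment> \<open>At \<open>(x0, a)\<close> the separating functional equals the squared distance
    to \<open>q\<close>, which is positive.\<close>
  then have "0 < u \<bullet> u + s * s"
    using sum_squares_gt_zero_iff[of "norm u" s] by (simp add: dot_square_norm power2_eq_square)
  then have strict: "0 < (x0 - q1) \<bullet> u + (a - q2) * s"
    by (simp add: u_def s_def)
  \<comment> \<open>The epigraph is closed under going up, so the outward normal cannot point
    upwards; the test point lies one unit above \<open>q\<close>.\<close>
  have "s \<le> 0"
  proof (rule ccontr)
    assume "\<not> s \<le> 0"
    moreover have "k q1 \<le> ereal (q2 + 1)"
      using q(1) by (auto simp: E_def q_eq intro: order_trans)
    ultimately show False using sep[of q1 "q2 + 1"] by simp
  qed
  then consider "s < 0" | "s = 0" by linarith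
  then show ?thesis
  proof cases
    case 1
    \<comment> \<open>Dividing by \<open>- s > 0\<close> solves the equation of the hyperplane for
      the vertical coordinate, giving an affine function of slope \<open>v\<close>.\<close>
    define v where "v = (1 / - s) *\<^sub>R u"
    have v: "x \<bullet> v + (q2 - q1 \<bullet> v) = q2 + (x - q1) \<bullet> u / - s" for x
      by (simp add: v_def inner_diff_left diff_divide_distrib)
    show ?thesis
    proof (rule that[of v "q2 - q1 \<bullet> v"])
      show "ereal (x \<bullet> v + (q2 - q1 \<bullet> v)) \<le> k x" for x
      proof (cases "k x")
        case (real r)
        then have "(x - q1) \<bullet> u \<le> (r - q2) * - s" using sep[of x r] by simp
        then have "(x - q1) \<bullet> u / - s \<le> r - q2"
          using 1 by (subst pos_divide_le_eq) auto
        then show ?thesis using real by (simp add: v)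
      qed (use nonneg[of x] in auto)
      have "(a - q2) * - s < (x0 - q1) \<bullet> u" using strict by simp
      then have "a - q2 < (x0 - q1) \<bullet> u / - s"
        using 1 by (subst pos_less_divide_eq) auto
      then show "a < x0 \<bullet> v + (q2 - q1 \<bullet> v)" by (simp add: v)
    qed
  next
    \<comment> \<open>The hyperplane is vertical; as \<open>k \<ge> 0\<close>, all positive multiples of its equation are minorants.\<close>
    case 2
    define w where "w = (x0 - q1) \<bullet> u"
    have "0 < w" using strict 2 by (simp add: w_def)
    \<comment> \<open>Scaled so that the value at \<open>x0\<close> becomes
      \<open>\<bar>a\<bar> + 1\<close>, which exceeds \<open>a\<close>.\<close>
    define N where "N = (\<bar>a\<bar> + 1) / w"
    have "0 \<le> N" using \<open>0 < w\<close> by (simp add: N_def)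
    have v: "x \<bullet> (N *\<^sub>R u) + - (N * (q1 \<bullet> u)) = N * ((x - q1) \<bullet> u)" for x
      by (simp add: inner_diff_left algebra_simps)
    show ?thesis
    proof (rule that[of "N *\<^sub>R u" "- (N * (q1 \<bullet> u))"])
      show "ereal (x \<bullet> (N *\<^sub>R u) + - (N * (q1 \<bullet> u))) \<le> k x" for x
      proof (cases "k x")
        case (real r)
        then have "(x - q1) \<bullet> u \<le> 0" using sep[of x r] 2 by simp
        then have "N * ((x - q1) \<bullet> u) \<le> 0"
          using \<open>0 \<le> N\<close> by (simp add: mult_nonneg_nonpos)
        then have "ereal (N * ((x - q1) \<bullet> u)) \<le> 0" by simp
        then show ?thesis unfolding v using nonneg[of x] by (rule order_trans)
      qed (use nonneg[of x] in auto)
      have "N * w = \<bar>a\<bar> + 1" using \<open>0 < w\<close> by (simp add: N_def)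
      then show "a < x0 \<bullet> (N *\<^sub>R u) + - (N * (q1 \<bullet> u))"
        unfolding v w_def[symmetric] by simp
    qed
  qed
qed

subsection \<open>The Legendre transform\<close>

lemma legendre_le_iff:
  "legendre g y \<le> c \<longleftrightarrow> (\<forall>x. ereal (x \<bullet> y) - g x \<le> c)"
  by (simp add: legendre_def SUP_le_iff)

text \<open>A supremum of functions of \<open>y\<close> that are continuous affine or constantly
  infinite: its strict superlevel sets are unions of open sets.\<close>

lemma legendre_lower_semicontinuous: "lower_semicontinuous (legendre g)"
  unfolding lower_semicontinuous_def
proof
  fix a
  have "open {y. a < ereal (x \<bullet> y) - g x}" for x
  proof (cases "g x")
    case (real r)
    have "continuous_on UNIV (\<lambda>y. ereal (x \<bullet> y - r))"
      by (intro continuous_intros)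
    then have "open {y. a < ereal (x \<bullet> y - r)}"
      by (intro open_Collect_less continuous_on_const)
    then show ?thesis using real by simp
  qed auto
  moreover have "{y. a < legendre g y} = (\<Union>x. {y. a < ereal (x \<bullet> y) - g x})"
    by (auto simp: legendre_def less_SUP_iff)
  ultimately show "open {y. a < legendre g y}" by auto
qed

text \<open>The epigraph of a supremum is the intersection of the epigraphs, here half-spaces, or
  the empty or whole space where \<open>g x\<close> is infinite.\<close>

lemma legendre_convex: "ereal_convex (legendre g)"
proof -
  have "convex {(y, r::real). ereal (x \<bullet> y) - g x \<le> ereal r}" for x
  proof (cases "g x")
    case (real c)
    have "{(y, r::real). ereal (x \<bullet> y) - g x \<le> ereal r} = {z. (x, -1) \<bullet> z \<le> c}"
      using real by (auto simp: inner_prod_def)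
    then show ?thesis by (simp add: convex_halfspace_le)
  qed auto
  moreover have "{(y, r::real). legendre g y \<le> ereal r} =
      (\<Inter>x. {(y, r::real). ereal (x \<bullet> y) - g x \<le> ereal r})"
    by (auto simp: legendre_le_iff)
  ultimately show ?thesis
    unfolding ereal_convex_def by (auto intro: convex_INT)
qed

text \<open>This is the Fenchel--Young inequality with its terms rearranged.\<close>

lemma biconjugate_le: "legendre (legendre g) x \<le> g x"
  unfolding legendre_le_iff
proof
  fix y
  have "ereal (x \<bullet> y) - g x \<le> legendre g y"
    unfolding legendre_def by (rule SUP_upper) simp
  then show "ereal (y \<bullet> x) - legendre g y \<le> g x"
    by (cases "g x"; cases "legendre g y") (auto simp: inner_commute)
qed

text \<open>A minorant of slope \<open>v\<close> bounds the conjugate at \<open>v\<close> by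
  \<open>- c\<close>; the term at \<open>v\<close> in the second supremum then recovers it.\<close>

lemma affine_minorant_le_biconjugate:
  assumes "\<And>x. ereal (x \<bullet> v + c) \<le> g x"
  shows "ereal (x \<bullet> v + c) \<le> legendre (legendre g) x"
proof -
  have "ereal (z \<bullet> v) - g z \<le> ereal (- c)" for z
    using assms[of z] by (cases "g z") auto
  then have "legendre g v \<le> ereal (- c)"
    by (simp add: legendre_le_iff)
  then have "ereal (x \<bullet> v + c) \<le> ereal (v \<bullet> x) - legendre g v"
    by (cases "legendre g v") (auto simp: inner_commute)
  also have "\<dots> \<le> legendre (legendre g) x"
    unfolding legendre_def[of "legendre g"] by (rule SUP_upper) simp
  finally show ?thesis .
qed

lemma biconjugate_is_lsc_convex_envelope:
  fixes g :: "'a::{real_inner, complete_space} \<Rightarrow> ereal"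
  assumes nonneg: "\<And>x. 0 \<le> g x"
  shows "is_lsc_convex_envelope (legendre (legendre g)) g"
  unfolding is_lsc_convex_envelope_def
proof (intro conjI allI impI)
  fix k x
  assume k: "lower_semicontinuous k \<and> ereal_convex k \<and> (\<forall>x. k x \<le> g x)"
  \<comment> \<open>Truncation at 0 preserves all three properties of \<open>k\<close>, the bound by
    \<open>g\<close> because \<open>g\<close> is nonnegative, and makes
    \<open>affine_minorant\<close> applicable.\<close>
  define k' where "k' x = max (k x) 0" for x
  have "{x. a < k' x} = {x. a < k x} \<union> {x. a < 0}" for a
    by (auto simp: k'_def less_max_iff_disj)
  then have lsc: "lower_semicontinuous k'"
    using k by (auto simp: lower_semicontinuous_def)
  have "{(x, r::real). k' x \<le> ereal r} = {(x, r::real). k x \<le> ereal r} \<inter> (UNIV \<times> {0..})"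
    by (auto simp: k'_def)
  then have conv: "ereal_convex k'"
    using k unfolding ereal_convex_def by (auto intro!: convex_Int convex_Times)
  have le: "k' x \<le> g x" for x
    using k nonneg by (auto simp: k'_def)
  have "k' x \<le> legendre (legendre g) x"
  proof (rule ccontr)
    assume "\<not> ?thesis"
    then obtain a where a: "legendre (legendre g) x < ereal a" "ereal a < k' x"
      using ereal_dense2 by (metis not_le)
    obtain v c where vc: "\<And>x. ereal (x \<bullet> v + c) \<le> k' x" "a < x \<bullet> v + c"
      using affine_minorant[OF lsc conv _ a(2)] by (auto simp: k'_def)
    have "ereal (x \<bullet> v + c) \<le> legendre (legendre g) x"
      using vc(1) le by (intro affine_minorant_le_biconjugate) (blast intro: order_trans)
    also have "\<dots> < ereal a" by fact
    finally show False using vc(2) by simp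
  qed
  then show "k x \<le> legendre (legendre g) x"
    by (simp add: k'_def)
qed (simp_all add: legendre_lower_semicontinuous legendre_convex biconjugate_le)

subsection \<open>The \<open>S\<close>-transform\<close>

text \<open>As a function of \<open>x\<close>, the left side is a concave quadratic with vertex
  \<open>y /\<^sub>R \<gamma> + d\<close>; this is where the argument of the
  \<open>S\<close>-transform comes from.\<close>

lemma complete_square:
  fixes x y d :: "'a::real_inner"
  assumes "0 < \<gamma>"
  shows "x \<bullet> y - \<gamma> / 2 * (norm (x - d))\<^sup>2
    = \<gamma> / 2 * (norm (y /\<^sub>R \<gamma> + d))\<^sup>2 - \<gamma> / 2 * (norm d)\<^sup>2
      - \<gamma> / 2 * (norm (x - (y /\<^sub>R \<gamma> + d)))\<^sup>2"
proof -
  define z where "z = y /\<^sub>R \<gamma> + d"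
  have "y = \<gamma> *\<^sub>R (z - d)" using assms by (simp add: z_def)
  then have "x \<bullet> y = \<gamma> * (x \<bullet> z) - \<gamma> * (x \<bullet> d)"
    by (simp add: inner_diff_right right_diff_distrib)
  then show ?thesis
    unfolding z_def[symmetric] power2_norm_eq_inner
    by (simp add: inner_diff_left inner_diff_right inner_commute algebra_simps)
qed

text \<open>After completing the square, the remainder \<open>C\<close> is real and independent of
  \<open>x\<close>, so it leaves the supremum.\<close>

lemma legendre_add_quadratic:
  fixes f :: "'a::real_inner \<Rightarrow> ereal"
  assumes "0 < \<gamma>"
  shows "legendre (\<lambda>x. f x + ereal (\<gamma> / 2 * (norm (x - d))\<^sup>2)) y
    = S_transform \<gamma> f (y /\<^sub>R \<gamma> + d)
      + ereal (\<gamma> / 2 * (norm (y /\<^sub>R \<gamma> + d))\<^sup>2) - ereal (\<gamma> / 2 * (norm d)\<^sup>2)"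
proof -
  define C where "C = \<gamma> / 2 * (norm (y /\<^sub>R \<gamma> + d))\<^sup>2 - \<gamma> / 2 * (norm d)\<^sup>2"
  have "x \<bullet> y - \<gamma> / 2 * (norm (x - d))\<^sup>2 = C - \<gamma> / 2 * (norm (x - (y /\<^sub>R \<gamma> + d)))\<^sup>2" for x
    using complete_square[OF assms, of x y d] by (simp add: C_def)
  then have "ereal (x \<bullet> y) - (f x + ereal (\<gamma> / 2 * (norm (x - d))\<^sup>2))
      = - f x - ereal (\<gamma> / 2 * (norm (x - (y /\<^sub>R \<gamma> + d)))\<^sup>2) + ereal C" for x
    by (cases "f x") (auto simp: algebra_simps)
  then have "legendre (\<lambda>x. f x + ereal (\<gamma> / 2 * (norm (x - d))\<^sup>2)) y
      = S_transform \<gamma> f (y /\<^sub>R \<gamma> + d) + ereal C"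
    unfolding legendre_def S_transform_def by (simp add: SUP_ereal_add_left)
  then show ?thesis
    by (cases "S_transform \<gamma> f (y /\<^sub>R \<gamma> + d)") (auto simp: C_def)
qed

text \<open>The same square, now with the supremum over \<open>y\<close>: the map sending
  \<open>y\<close> to \<open>y /\<^sub>R \<gamma> + d\<close> is onto, so the supremum may run over
  its values \<open>z\<close> instead.\<close>

lemma legendre_affine_substitution:
  fixes g :: "'a::real_inner \<Rightarrow> ereal"
  assumes "0 < \<gamma>"
  shows "legendre (\<lambda>y. g (y /\<^sub>R \<gamma> + d)
      + ereal (\<gamma> / 2 * (norm (y /\<^sub>R \<gamma> + d))\<^sup>2) - ereal (\<gamma> / 2 * (norm d)\<^sup>2)) x
    = S_transform \<gamma> g x + ereal (\<gamma> / 2 * (norm (x - d))\<^sup>2)"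
proof -
  define C where "C = \<gamma> / 2 * (norm (x - d))\<^sup>2"
  define h where "h z = - g z - ereal (\<gamma> / 2 * (norm (z - x))\<^sup>2) + ereal C" for z
  have "y \<bullet> x - \<gamma> / 2 * (norm (y /\<^sub>R \<gamma> + d))\<^sup>2 + \<gamma> / 2 * (norm d)\<^sup>2
      = C - \<gamma> / 2 * (norm (y /\<^sub>R \<gamma> + d - x))\<^sup>2" for y
    using complete_square[OF assms, of x y d]
    by (simp add: C_def inner_commute norm_minus_commute)
  then have "ereal (y \<bullet> x) - (g (y /\<^sub>R \<gamma> + d)
      + ereal (\<gamma> / 2 * (norm (y /\<^sub>R \<gamma> + d))\<^sup>2) - ereal (\<gamma> / 2 * (norm d)\<^sup>2))
      = h (y /\<^sub>R \<gamma> + d)" for y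
    unfolding h_def by (cases "g (y /\<^sub>R \<gamma> + d)") (auto simp: algebra_simps)
  then have "legendre (\<lambda>y. g (y /\<^sub>R \<gamma> + d)
      + ereal (\<gamma> / 2 * (norm (y /\<^sub>R \<gamma> + d))\<^sup>2) - ereal (\<gamma> / 2 * (norm d)\<^sup>2)) x
      = (SUP y. h (y /\<^sub>R \<gamma> + d))"
    unfolding legendre_def by simp
  also have "\<dots> = (SUP z\<in>range (\<lambda>y. y /\<^sub>R \<gamma> + d). h z)"
    by (simp add: image_image)
  also have "range (\<lambda>y. y /\<^sub>R \<gamma> + d) = UNIV"
    by (rule surjI[of _ "\<lambda>z. \<gamma> *\<^sub>R (z - d)"]) (use assms in simp)
  also have "(SUP z. h z) = S_transform \<gamma> g x + ereal C"
    unfolding h_def S_transform_def by (rule SUP_ereal_add_left) auto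
  finally show ?thesis by (simp add: C_def)
qed

lemma S_transform_nonpos:
  assumes "\<forall>x. 0 \<le> f x" "0 < \<gamma>"
  shows "S_transform \<gamma> f y \<le> 0"
  unfolding S_transform_def
proof (rule SUP_least)
  fix x
  have "0 \<le> \<gamma> / 2 * (norm (x - y))\<^sup>2" using assms(2) by simp
  then show "- f x - ereal (\<gamma> / 2 * (norm (x - y))\<^sup>2) \<le> 0"
    using assms(1)[rule_format, of x] by (cases "f x") auto
qed

text \<open>The quadratic vanishes at the centre. Applied to \<open>S_transform \<gamma> f\<close>,
  which is nonpositive, this makes the double transform nonnegative.\<close>

lemma uminus_le_S_transform: "- f x \<le> S_transform \<gamma> f x"
  using SUP_upper[of x UNIV "\<lambda>z. - f z - ereal (\<gamma> / 2 * (norm (z - x))\<^sup>2)"]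
  by (simp add: S_transform_def)

text \<open>The kernel is symmetric and real, so in the inequality bounding a term of the first
  supremum, \<open>f x\<close> and \<open>S_transform \<gamma> f y\<close> can trade places.\<close>

lemma S_transform_S_transform_le: "S_transform \<gamma> (S_transform \<gamma> f) x \<le> f x"
  unfolding S_transform_def[of _ "S_transform \<gamma> f"]
proof (rule SUP_least)
  fix y
  have "- f x - ereal (\<gamma> / 2 * (norm (x - y))\<^sup>2) \<le> S_transform \<gamma> f y"
    unfolding S_transform_def by (rule SUP_upper) simp
  then show "- S_transform \<gamma> f y - ereal (\<gamma> / 2 * (norm (y - x))\<^sup>2) \<le> f x"
    by (cases "f x"; cases "S_transform \<gamma> f y") (auto simp: norm_minus_commute)
qed

theorem theorem2p2:
  fixes f :: "'a::{real_inner, complete_space} \<Rightarrow> ereal" and \<gamma> :: real and d :: 'a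
  assumes separable: "separable_space (euclidean :: 'a topology)"
    and nonneg: "\<forall>x. 0 \<le> f x"
    and gamma_pos: "0 < \<gamma>"
  shows "(\<forall>y. legendre (\<lambda>x. f x + ereal (\<gamma> / 2 * (norm (x - d))\<^sup>2)) y
            = S_transform \<gamma> f (y /\<^sub>R \<gamma> + d)
              + ereal (\<gamma> / 2 * (norm (y /\<^sub>R \<gamma> + d))\<^sup>2) - ereal (\<gamma> / 2 * (norm d)\<^sup>2))
    \<and> (\<forall>x. legendre (\<lambda>y. S_transform \<gamma> f (y /\<^sub>R \<gamma> + d)
              + ereal (\<gamma> / 2 * (norm (y /\<^sub>R \<gamma> + d))\<^sup>2) - ereal (\<gamma> / 2 * (norm d)\<^sup>2)) x
            = S_transform \<gamma> (S_transform \<gamma> f) x + ereal (\<gamma> / 2 * (norm (x - d))\<^sup>2))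
    \<and> is_lsc_convex_envelope
        (\<lambda>x. S_transform \<gamma> (S_transform \<gamma> f) x + ereal (\<gamma> / 2 * (norm (x - d))\<^sup>2))
        (\<lambda>x. f x + ereal (\<gamma> / 2 * (norm (x - d))\<^sup>2))
    \<and> (\<forall>x. 0 \<le> S_transform \<gamma> (S_transform \<gamma> f) x \<and> S_transform \<gamma> (S_transform \<gamma> f) x \<le> f x)"
proof (intro conjI allI)
  let ?F = "\<lambda>x. f x + ereal (\<gamma> / 2 * (norm (x - d))\<^sup>2)"
  let ?G = "\<lambda>y. S_transform \<gamma> f (y /\<^sub>R \<gamma> + d)
    + ereal (\<gamma> / 2 * (norm (y /\<^sub>R \<gamma> + d))\<^sup>2) - ereal (\<gamma> / 2 * (norm d)\<^sup>2)"
  let ?H = "\<lambda>x. S_transform \<gamma> (S_transform \<gamma> f) x + ereal (\<gamma> / 2 * (norm (x - d))\<^sup>2)"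
  show F: "legendre ?F y = ?G y" for y
    by (rule legendre_add_quadratic[OF gamma_pos])
  show G: "legendre ?G x = ?H x" for x
    by (rule legendre_affine_substitution[OF gamma_pos])
  have "legendre ?F = ?G" "legendre ?G = ?H"
    by (rule ext, rule F) (rule ext, rule G)
  then have "legendre (legendre ?F) = ?H"
    by (rule trans[OF arg_cong[where f = legendre]])
  moreover have "0 \<le> ?F x" for x
    using nonneg gamma_pos by (intro add_nonneg_nonneg) auto
  ultimately show "is_lsc_convex_envelope ?H ?F"
    using biconjugate_is_lsc_convex_envelope[of ?F] by simp
  show "0 \<le> S_transform \<gamma> (S_transform \<gamma> f) x" for x
  proof -
    have "0 \<le> - S_transform \<gamma> f x"
      using S_transform_nonpos[OF nonneg gamma_pos, of x] by simp
    then show ?thesis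
      using uminus_le_S_transform by (rule order_trans)
  qed
  show "S_transform \<gamma> (S_transform \<gamma> f) x \<le> f x" for x
    by (rule S_transform_S_transform_le)
qed

end
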